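(* Let $X$ be a 1-walk regular graph with clique number $\omega$. For a graph $Y$ on at most $\omega$ vertices and an injective map $\iota:V(Y)\to V(X)$ whose image is a clique of $X$, let $X_{Y,\iota}$ denote the graph obtained from $X$ by deleting the edges $\{\iota(a),\iota(b)\}$ for all edges $\{a,b\}$ of $Y$. (a) If $Y_1$ and $Y_2$ are two Laplacian cospectral graphs on at most $\omega$ vertices, then for any injective maps $\iota_1:V(Y_1)\to V(X)$, $\iota_2:V(Y_2)\to V(X)$ with images cliques of $X$, the graphs $X_{Y_1,\iota_1}$ and $X_{Y_2,\iota_2}$ are Laplacian cospectral. (b) If $Y_1$ and $Y_2$ are two graphs on at most $\omega$ vertices that are unsigned Laplacian cospectral and whose complements are also unsigned Laplacian cospectral, then for any injective maps $\iota_1:V(Y_1)\to V(X)$, $\iota_2:V(Y_2)\to V(X)$ with images cliques of $X$, the graphs $X_{Y_1,\iota_1}$ and $X_{Y_2,\iota_2}$ are unsigned Laplacian cospectral.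
   Context: A graph is 1-walk regular if for every positive integer $k$ the number of closed walks of length $k$ at a vertex is the same for all vertices, and the number of walks of length $k$ from $u$ to $v$ is the same for all pairs of adjacent vertices $u,v$. The clique number is the largest size of a set of pairwise adjacent vertices. Laplacian $L=D-A$, unsigned Laplacian $S=D+A$ ($A$ adjacency matrix, $D$ diagonal degree matrix); cospectral with respect to a matrix means equal characteristic polynomials. *)

theory Defs
  imports "Graph_Theory.Pair_Digraph" "Jordan_Normal_Form.Char_Poly"
begin

text \<open>
  Finite simple graphs are the \<^locale>\<open>pair_graph\<close>s of the library: an edge $\{u,v\}$ is the pair of
  arcs \<open>(u,v)\<close>, \<open>(v,u)\<close>. The null graph is allowed.
\<close>

subsection \<open>Cliques, complements, and deletion of a copy of a graph\<close>

definition clique :: "'a pair_pre_digraph \<Rightarrow> 'a set \<Rightarrow> bool" where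
  "clique G K \<longleftrightarrow> K \<subseteq> pverts G \<and> (\<forall>u\<in>K. \<forall>v\<in>K. u \<noteq> v \<longrightarrow> (u, v) \<in> parcs G)"

definition clique_number :: "'a pair_pre_digraph \<Rightarrow> nat" where
  "clique_number G = Max {card K |K. clique G K}"

definition complement :: "'a pair_pre_digraph \<Rightarrow> 'a pair_pre_digraph" where
  "complement G = \<lparr>pverts = pverts G,
     parcs = {(u, v). u \<in> pverts G \<and> v \<in> pverts G \<and> u \<noteq> v \<and> (u, v) \<notin> parcs G}\<rparr>"

definition delete_copy ::
    "'a pair_pre_digraph \<Rightarrow> 'b pair_pre_digraph \<Rightarrow> ('b \<Rightarrow> 'a) \<Rightarrow> 'a pair_pre_digraph" where
  "delete_copy X Y \<iota> = \<lparr>pverts = pverts X, parcs = parcs X - {(\<iota> a, \<iota> b) |a b. (a, b) \<in> parcs Y}\<rparr>"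

lemma pair_graph_complement:
  assumes "pair_graph G"
  shows "pair_graph (complement G)"
proof -
  interpret pair_graph G by fact
  have "finite (parcs (complement G))"
    by (rule finite_subset[of _ "pverts G \<times> pverts G"]) (auto simp: complement_def pair_finite_verts)
  then show ?thesis
    by unfold_locales
      (auto simp: complement_def symmetric_def sym_def pair_finite_verts dest: arcs_symmetric)
qed

lemma pair_graph_delete_copy:
  assumes "pair_graph X" and "pair_graph Y"
  shows "pair_graph (delete_copy X Y \<iota>)"
proof -
  interpret X: pair_graph X by fact
  interpret Y: pair_graph Y by fact
  show ?thesis
    by unfold_locales
      (auto simp: delete_copy_def symmetric_def sym_def X.pair_finite_verts X.pair_finite_arcs
         X.in_arcsD1 X.in_arcsD2 X.no_loops' dest: X.arcs_symmetric Y.arcs_symmetric)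
qed


subsection \<open>1-walk regularity\<close>

definition num_walks :: "'a pair_pre_digraph \<Rightarrow> nat \<Rightarrow> 'a \<Rightarrow> 'a \<Rightarrow> nat" where
  "num_walks G k u v = card {p. pre_digraph.awalk (with_proj G) u p v \<and> length p = k}"

definition one_walk_regular :: "'a pair_pre_digraph \<Rightarrow> bool" where
  "one_walk_regular G \<longleftrightarrow> (\<forall>k>0.
     (\<forall>u\<in>pverts G. \<forall>v\<in>pverts G. num_walks G k u u = num_walks G k v v) \<and>
     (\<forall>(u, v)\<in>parcs G. \<forall>(x, y)\<in>parcs G. num_walks G k u v = num_walks G k x y))"


subsection \<open>Graph matrices and cospectrality\<close>

text \<open>
  Rows and columns follow an enumeration \<open>xs\<close> of the vertices.
\<close>

definition adjacency_mat :: "'a list \<Rightarrow> 'a pair_pre_digraph \<Rightarrow> real mat" where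
  "adjacency_mat xs G = mat (length xs) (length xs)
     (\<lambda>(i, j). if (xs ! i, xs ! j) \<in> parcs G then 1 else 0)"

definition degree_mat :: "'a list \<Rightarrow> 'a pair_pre_digraph \<Rightarrow> real mat" where
  "degree_mat xs G = mat (length xs) (length xs)
     (\<lambda>(i, j). if i = j then real (out_degree (with_proj G) (xs ! i)) else 0)"

definition laplacian_mat :: "'a list \<Rightarrow> 'a pair_pre_digraph \<Rightarrow> real mat" where
  "laplacian_mat xs G = degree_mat xs G - adjacency_mat xs G"

definition unsigned_laplacian_mat :: "'a list \<Rightarrow> 'a pair_pre_digraph \<Rightarrow> real mat" where
  "unsigned_laplacian_mat xs G = degree_mat xs G + adjacency_mat xs G"

definition vertex_enum :: "'a pair_pre_digraph \<Rightarrow> 'a list" where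
  "vertex_enum G = (SOME xs. set xs = pverts G \<and> distinct xs)"

text \<open>
  The choice of enumeration is immaterial, see \<open>laplacian_char_poly_eq\<close> and
  \<open>unsigned_laplacian_char_poly_eq\<close> below.
\<close>

definition laplacian_char_poly :: "'a pair_pre_digraph \<Rightarrow> real poly" where
  "laplacian_char_poly G = char_poly (laplacian_mat (vertex_enum G) G)"

definition unsigned_laplacian_char_poly :: "'a pair_pre_digraph \<Rightarrow> real poly" where
  "unsigned_laplacian_char_poly G = char_poly (unsigned_laplacian_mat (vertex_enum G) G)"

definition laplacian_cospectral :: "'a pair_pre_digraph \<Rightarrow> 'b pair_pre_digraph \<Rightarrow> bool" where
  "laplacian_cospectral G H \<longleftrightarrow> laplacian_char_poly G = laplacian_char_poly H"

definition unsigned_laplacian_cospectral ::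
    "'a pair_pre_digraph \<Rightarrow> 'b pair_pre_digraph \<Rightarrow> bool" where
  "unsigned_laplacian_cospectral G H \<longleftrightarrow>
     unsigned_laplacian_char_poly G = unsigned_laplacian_char_poly H"

lemma vertex_enum:
  assumes "finite (pverts G)"
  shows "set (vertex_enum G) = pverts G" "distinct (vertex_enum G)"
  using someI_ex[OF finite_distinct_list[OF assms]] by (simp_all add: vertex_enum_def)

lemma char_poly_reindex:
  fixes f :: "'a \<Rightarrow> 'a \<Rightarrow> 'b :: comm_ring_1"
  assumes xs: "distinct xs" and ys: "distinct ys" and set_eq: "set xs = set ys"
  shows "char_poly (mat (length xs) (length xs) (\<lambda>(i, j). f (xs ! i) (xs ! j))) =
         char_poly (mat (length ys) (length ys) (\<lambda>(i, j). f (ys ! i) (ys ! j)))"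
    (is "char_poly ?A = char_poly ?B")
proof -
  define n where "n = length xs"
  have len: "length xs = n" "length ys = n"
    using assms by (simp_all add: n_def) (metis distinct_card)
  define P :: "'b mat" where "P = mat n n (\<lambda>(i, j). if xs ! i = ys ! j then 1 else 0)"
  define Q :: "'b mat" where "Q = mat n n (\<lambda>(i, j). if ys ! i = xs ! j then 1 else 0)"
  have sum_reindex: "(\<Sum>k = 0..<n. g (zs ! k)) = sum g (set zs)"
    if "distinct zs" "length zs = n" for zs :: "'a list" and g :: "'a \<Rightarrow> 'b"
    using that by (intro sum.reindex_bij_betw) (auto intro!: bij_betw_nth)
  have mem: "xs ! i \<in> set ys" "ys ! i \<in> set xs" if "i < n" for i
    using that len set_eq by (metis nth_mem)+
  have PQ: "P * Q = 1\<^sub>m n"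
  proof (rule eq_matI)
    fix i j assume ij: "i < dim_row (1\<^sub>m n :: 'b mat)" "j < dim_col (1\<^sub>m n :: 'b mat)"
    then have "(P * Q) $$ (i, j) =
        (\<Sum>k = 0..<n. (if xs ! i = ys ! k then 1 else 0) * (if ys ! k = xs ! j then 1 else 0))"
      by (simp add: P_def Q_def scalar_prod_def)
    also have "\<dots> = (\<Sum>v\<in>set ys. (if xs ! i = v then 1 else 0) * (if v = xs ! j then 1 else 0))"
      by (rule sum_reindex[OF ys len(2)])
    also have "\<dots> = (\<Sum>v\<in>set ys. if xs ! i = v then (if v = xs ! j then 1 else 0) else 0)"
      by (rule sum.cong) auto
    also have "\<dots> = (1\<^sub>m n :: 'b mat) $$ (i, j)"
      using ij mem xs len by (simp add: nth_eq_iff_index_eq)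
    finally show "(P * Q) $$ (i, j) = (1\<^sub>m n :: 'b mat) $$ (i, j)" .
  qed (simp_all add: P_def Q_def)
  have QP: "Q * P = 1\<^sub>m n"
  proof (rule eq_matI)
    fix i j assume ij: "i < dim_row (1\<^sub>m n :: 'b mat)" "j < dim_col (1\<^sub>m n :: 'b mat)"
    then have "(Q * P) $$ (i, j) =
        (\<Sum>k = 0..<n. (if ys ! i = xs ! k then 1 else 0) * (if xs ! k = ys ! j then 1 else 0))"
      by (simp add: P_def Q_def scalar_prod_def)
    also have "\<dots> = (\<Sum>v\<in>set xs. (if ys ! i = v then 1 else 0) * (if v = ys ! j then 1 else 0))"
      by (rule sum_reindex[OF xs len(1)])
    also have "\<dots> = (\<Sum>v\<in>set xs. if ys ! i = v then (if v = ys ! j then 1 else 0) else 0)"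
      by (rule sum.cong) auto
    also have "\<dots> = (1\<^sub>m n :: 'b mat) $$ (i, j)"
      using ij mem ys len by (simp add: nth_eq_iff_index_eq)
    finally show "(Q * P) $$ (i, j) = (1\<^sub>m n :: 'b mat) $$ (i, j)" .
  qed (simp_all add: P_def Q_def)
  have PB: "P * ?B = mat n n (\<lambda>(i, j). f (xs ! i) (ys ! j))"
  proof (rule eq_matI)
    fix i j assume ij: "i < dim_row (mat n n (\<lambda>(i, j). f (xs ! i) (ys ! j)))"
      "j < dim_col (mat n n (\<lambda>(i, j). f (xs ! i) (ys ! j)))"
    then have "(P * ?B) $$ (i, j) =
        (\<Sum>k = 0..<n. (if xs ! i = ys ! k then 1 else 0) * f (ys ! k) (ys ! j))"
      by (simp add: P_def scalar_prod_def len)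
    also have "\<dots> = (\<Sum>v\<in>set ys. (if xs ! i = v then 1 else 0) * f v (ys ! j))"
      by (rule sum_reindex[OF ys len(2)])
    also have "\<dots> = (\<Sum>v\<in>set ys. if xs ! i = v then f v (ys ! j) else 0)"
      by (rule sum.cong) auto
    also have "\<dots> = f (xs ! i) (ys ! j)"
      using ij mem by simp
    finally show "(P * ?B) $$ (i, j) = mat n n (\<lambda>(i, j). f (xs ! i) (ys ! j)) $$ (i, j)"
      using ij by simp
  qed (simp_all add: P_def len)
  have PBQ: "P * ?B * Q = ?A"
  proof (rule eq_matI)
    fix i j assume ij: "i < dim_row ?A" "j < dim_col ?A"
    then have "(P * ?B * Q) $$ (i, j) =
        (\<Sum>k = 0..<n. f (xs ! i) (ys ! k) * (if ys ! k = xs ! j then 1 else 0))"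
      unfolding PB by (simp add: Q_def scalar_prod_def len)
    also have "\<dots> = (\<Sum>v\<in>set ys. f (xs ! i) v * (if v = xs ! j then 1 else 0))"
      by (rule sum_reindex[OF ys len(2)])
    also have "\<dots> = (\<Sum>v\<in>set ys. if v = xs ! j then f (xs ! i) v else 0)"
      by (rule sum.cong) auto
    also have "\<dots> = f (xs ! i) (xs ! j)"
      using ij mem len by simp
    finally show "(P * ?B * Q) $$ (i, j) = ?A $$ (i, j)"
      using ij by simp
  qed (simp_all add: P_def Q_def len)
  have "similar_mat ?A ?B"
    by (rule similar_matI[of _ _ P Q n]) (use PQ QP PBQ in \<open>auto simp: P_def Q_def len\<close>)
  then show ?thesis
    by (rule char_poly_similar)
qed

lemma laplacian_char_poly_eq:
  assumes "finite (pverts G)" "set xs = pverts G" "distinct xs"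
  shows "laplacian_char_poly G = char_poly (laplacian_mat xs G)"
proof -
  define f where "f u v = (if u = v then real (out_degree (with_proj G) u) else 0) -
    (if (u, v) \<in> parcs G then 1 else 0)" for u v
  have "laplacian_mat zs G = mat (length zs) (length zs) (\<lambda>(i, j). f (zs ! i) (zs ! j))"
    if "distinct zs" for zs
    using that by (intro eq_matI)
      (auto simp: laplacian_mat_def degree_mat_def adjacency_mat_def f_def nth_eq_iff_index_eq)
  then show ?thesis
    using char_poly_reindex[of "vertex_enum G" xs f] vertex_enum[OF assms(1)] assms(2,3)
    by (simp add: laplacian_char_poly_def)
qed

lemma unsigned_laplacian_char_poly_eq:
  assumes "finite (pverts G)" "set xs = pverts G" "distinct xs"
  shows "unsigned_laplacian_char_poly G = char_poly (unsigned_laplacian_mat xs G)"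
proof -
  define f where "f u v = (if u = v then real (out_degree (with_proj G) u) else 0) +
    (if (u, v) \<in> parcs G then 1 else 0)" for u v
  have "unsigned_laplacian_mat zs G = mat (length zs) (length zs) (\<lambda>(i, j). f (zs ! i) (zs ! j))"
    if "distinct zs" for zs
    using that by (intro eq_matI)
      (auto simp: unsigned_laplacian_mat_def degree_mat_def adjacency_mat_def f_def
         nth_eq_iff_index_eq)
  then show ?thesis
    using char_poly_reindex[of "vertex_enum G" xs f] vertex_enum[OF assms(1)] assms(2,3)
    by (simp add: unsigned_laplacian_char_poly_def)
qed

end

theory Submission
  imports Defs
begin

text \<open>
  Write $M(t) = tI - dI \mp A$ for the matrix whose determinant is the (unsigned) Laplacian
  characteristic polynomial of the $d$-regular graph $X$. Deleting the copy of $Y$ adds the (unsigned)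
  Laplacian $S$ of $Y$ to the block of $M(t)$ indexed by the clique, so the determinant is multiplied by
  $\det(I + KS)$, where $K$ is the clique block of $M(t)^{-1}$. For large $t$ the Neumann series writes
  $M(t)^{-1}$ in terms of walk counts, and 1-walk regularity gives $K = cI + bJ$ with $c$ and $b$
  independent of the clique.

  For the Laplacian, $JS = 0$ leaves $\det(I + cS)$, a value of the characteristic polynomial of $S$.
  For the unsigned Laplacian, $\det(I + KS) = \det K \cdot \det(S + c^{-1} I + yJ)$ for some $y$. The
  last determinant is affine in $y$, and its values at $y = 0$ and $y = -1$ are values of the characteristic
  polynomials of $S$ and of the unsigned Laplacian $(m-2)I + J - S$ of the complement of $Y$.
\<close>

subsection \<open>Determinants\<close>

definition all_ones_mat :: "nat \<Rightarrow> 'a :: one mat" where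
  "all_ones_mat n = mat n n (\<lambda>_. 1)"

lemma all_ones_mat_carrier [simp]: "all_ones_mat n \<in> carrier_mat n n"
  by (simp add: all_ones_mat_def)

lemma all_ones_mat_dim [simp]: "dim_row (all_ones_mat n) = n" "dim_col (all_ones_mat n) = n"
  by (simp_all add: all_ones_mat_def)

lemma all_ones_mat_index [simp]: "i < n \<Longrightarrow> j < n \<Longrightarrow> all_ones_mat n $$ (i, j) = 1"
  by (simp add: all_ones_mat_def)

text \<open>The all-ones matrix \<open>J\<close> has rank one, so \<open>det (P + x J)\<close> is
  affine in \<open>x\<close> and is determined by its values at \<open>0\<close> and
  \<open>-1\<close>. Affinity is seen by bordering \<open>P\<close> with one extra row and column
  and expanding along the new row.\<close>

lemma det_add_smult_all_ones:
  fixes P :: "'a :: idom mat"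
  assumes P: "P \<in> carrier_mat n n"
  shows "det (P + x \<cdot>\<^sub>m all_ones_mat n) = (1 + x) * det P - x * det (P - all_ones_mat n)"
proof -
  define c :: "'a mat" where "c = mat n 1 (\<lambda>_. 1)"
  define r :: "'a \<Rightarrow> 'a mat" where "r y = mat 1 n (\<lambda>_. - y)" for y
  \<comment> \<open>Subtracting the first row of \<open>G y\<close> from all others clears the first
    column below the corner and turns \<open>P\<close> into \<open>P + y J\<close>.\<close>
  define G where "G y = four_block_mat (1\<^sub>m 1) (r y) c P" for y
  have [simp]: "c \<in> carrier_mat n 1" "r y \<in> carrier_mat 1 n" for y
    by (simp_all add: c_def r_def)
  have [simp]: "c \<in> carrier_mat n (Suc 0)" "r y \<in> carrier_mat (Suc 0) n" for y
    by (simp_all add: c_def r_def)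
  have G [simp]: "G y \<in> carrier_mat (Suc n) (Suc n)" for y
    using P unfolding G_def by (metis One_nat_def four_block_carrier_mat one_carrier_mat plus_1_eq_Suc)
  have det_G: "det (G y) = det (P + y \<cdot>\<^sub>m all_ones_mat n)" for y
  proof -
    define E where "E = four_block_mat (1\<^sub>m 1) (0\<^sub>m 1 n) (- c) (1\<^sub>m n)"
    have E: "E \<in> carrier_mat (Suc n) (Suc n)"
      unfolding E_def by (metis One_nat_def four_block_carrier_mat one_carrier_mat plus_1_eq_Suc)
    have "det E = 1"
      unfolding E_def by (subst det_four_block_mat_upper_right_zero) auto
    have cr: "- c * r y + 1\<^sub>m n * P = P + y \<cdot>\<^sub>m all_ones_mat n"
      using P by (intro eq_matI) (auto simp: c_def r_def scalar_prod_def)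
    have cc: "- c * 1\<^sub>m 1 + 1\<^sub>m n * c = 0\<^sub>m n 1"
      by (intro eq_matI) (auto simp: c_def)
    have one: "1\<^sub>m 1 * 1\<^sub>m 1 + 0\<^sub>m 1 n * c = 1\<^sub>m 1"
      using left_mult_zero_mat[of c n 1 1] by simp
    have r: "1\<^sub>m 1 * r y + 0\<^sub>m 1 n * P = r y"
      using left_mult_one_mat[of "r y" 1 n] right_add_zero_mat[of "r y" 1 n] P by simp
    have "E * G y = four_block_mat (1\<^sub>m 1 * 1\<^sub>m 1 + 0\<^sub>m 1 n * c) (1\<^sub>m 1 * r y + 0\<^sub>m 1 n * P)
        (- c * 1\<^sub>m 1 + 1\<^sub>m n * c) (- c * r y + 1\<^sub>m n * P)"
      unfolding E_def G_def by (rule mult_four_block_mat) (use P in auto)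
    also have "\<dots> = four_block_mat (1\<^sub>m 1) (r y) (0\<^sub>m n 1) (P + y \<cdot>\<^sub>m all_ones_mat n)"
      unfolding cr cc one r using P by simp
    finally have "det (E * G y) = det (P + y \<cdot>\<^sub>m all_ones_mat n)"
      using P by (simp add: det_four_block_mat_lower_left_zero[where n = 1 and m = n])
    then show ?thesis
      using det_mult[OF E G] \<open>det E = 1\<close> by simp
  qed
  \<comment> \<open>Cofactors along row 0 omit that row, the only one in which \<open>y\<close>
    occurs, so one family of cofactors serves all \<open>y\<close>.\<close>
  define C where "C j = cofactor (G 0) 0 j" for j
  have "cofactor (G y) 0 j = C j" for y j
  proof -
    have "mat_delete (G y) 0 j = mat_delete (G 0) 0 j"
      using P by (intro eq_matI) (auto simp: mat_delete_def G_def r_def)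
    then show ?thesis
      by (simp add: C_def cofactor_def)
  qed
  then have "det (G y) = (\<Sum>j<Suc n. G y $$ (0, j) * C j)" for y
    using laplace_expansion_row[OF G, of 0 y] by simp
  moreover have "(\<Sum>j<Suc n. G y $$ (0, j) * C j) = C 0 - y * (\<Sum>j<n. C (Suc j))" for y
    using P unfolding sum.lessThan_Suc_shift
    by (simp add: G_def r_def sum_distrib_left sum_negf[symmetric])
  ultimately have affine: "det (P + y \<cdot>\<^sub>m all_ones_mat n) = C 0 - y * (\<Sum>j<n. C (Suc j))" for y
    by (simp add: det_G)
  have "P + 0 \<cdot>\<^sub>m all_ones_mat n = P" "P + (-1) \<cdot>\<^sub>m all_ones_mat n = P - all_ones_mat n"
    using P by (auto intro!: eq_matI)
  then show ?thesis
    using affine[of x] affine[of 0] affine[of "-1"] by (simp add: algebra_simps)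
qed

text \<open>Let \<open>N\<close> be the right inverse of \<open>M\<close> and \<open>S'\<close> the
  padding of \<open>S\<close> by zeros. Then \<open>M + S' = M (I + N S')\<close>, and the last
  \<open>k\<close> columns of \<open>N S'\<close> vanish. The second factor is therefore block lower
  triangular, and of \<open>N\<close> only the corner \<open>N1\<close> enters its
  determinant.\<close>

lemma det_add_corner:
  fixes M :: "'a :: idom mat"
  assumes M: "M \<in> carrier_mat (m + k) (m + k)" and S: "S \<in> carrier_mat m m"
    and N: "N1 \<in> carrier_mat m m" "N2 \<in> carrier_mat m k" "N3 \<in> carrier_mat k m" "N4 \<in> carrier_mat k k"
    and MN: "M * four_block_mat N1 N2 N3 N4 = 1\<^sub>m (m + k)"
  shows "det (M + four_block_mat S (0\<^sub>m m k) (0\<^sub>m k m) (0\<^sub>m k k)) = det M * det (1\<^sub>m m + N1 * S)"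
proof -
  let ?N = "four_block_mat N1 N2 N3 N4" and ?S = "four_block_mat S (0\<^sub>m m k) (0\<^sub>m k m) (0\<^sub>m k k)"
  have Nc: "?N \<in> carrier_mat (m + k) (m + k)" and Sc: "?S \<in> carrier_mat (m + k) (m + k)"
    using N S by auto
  have "?N * ?S = four_block_mat (N1 * S) (0\<^sub>m m k) (N3 * S) (0\<^sub>m k k)"
    by (subst mult_four_block_mat[of _ m m _ k _ k _ _ m _ k]) (use N S in auto)
  then have "1\<^sub>m (m + k) + ?N * ?S = four_block_mat (1\<^sub>m m + N1 * S) (0\<^sub>m m k) (N3 * S) (1\<^sub>m k)"
    using N S by (auto intro!: eq_matI)
  then have det: "det (1\<^sub>m (m + k) + ?N * ?S) = det (1\<^sub>m m + N1 * S)"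
    using N S by (simp add: det_four_block_mat_upper_right_zero[where n = m and m = k])
  have "M * (1\<^sub>m (m + k) + ?N * ?S) = M * 1\<^sub>m (m + k) + M * (?N * ?S)"
    by (rule mult_add_distrib_mat) (use M Nc Sc in auto)
  also have "M * (?N * ?S) = M * ?N * ?S"
    by (rule assoc_mult_mat[symmetric]) (use M Nc Sc in auto)
  finally have "M * (1\<^sub>m (m + k) + ?N * ?S) = M + ?S"
    unfolding MN using M left_mult_one_mat[OF Sc] by simp
  then show ?thesis
    using det_mult[OF M, of "1\<^sub>m (m + k) + ?N * ?S"] Nc Sc det by simp
qed

section \<open>Determinants as values of characteristic polynomials\<close>

lemma poly_char_poly:
  fixes A :: "'a :: field mat"
  assumes "A \<in> carrier_mat n n"
  shows "poly (char_poly A) x = det (x \<cdot>\<^sub>m 1\<^sub>m n - A)"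
proof -
  have "- char_matrix A x = x \<cdot>\<^sub>m 1\<^sub>m n - A"
    using assms by (auto simp: char_matrix_def intro!: eq_matI)
  then show ?thesis
    by (simp add: char_poly_matrix[OF assms])
qed

lemma det_one_add_smult:
  fixes S :: "'a :: field mat"
  assumes S: "S \<in> carrier_mat n n" and "c \<noteq> 0"
  shows "det (1\<^sub>m n + c \<cdot>\<^sub>m S) = (- c) ^ n * poly (char_poly S) (- 1 / c)"
proof -
  have "1\<^sub>m n + c \<cdot>\<^sub>m S = (- c) \<cdot>\<^sub>m ((- 1 / c) \<cdot>\<^sub>m 1\<^sub>m n - S)"
    using assms by (intro eq_matI) (auto simp: field_simps)
  then show ?thesis
    using S by (simp add: poly_char_poly[OF S])
qed

text \<open>For \<open>K = c I + b J\<close>, the conditions on \<open>c\<close> and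
  \<open>c + n b\<close> make the eigenvalues of \<open>K\<close> nonzero, and the inverse is
  \<open>(1 / c) I + y J\<close>. Factoring out \<open>K\<close> leaves
  \<open>S + (1 / c) I + y J\<close>, whose determinant is affine in \<open>y\<close>.
  \<open>T\<close> stands for the unsigned Laplacian of the complement; the integer difference
  \<open>int n - 2\<close> stays correct for \<open>n < 2\<close>.\<close>

lemma det_one_add_mult_all_ones:
  fixes S :: "'a :: field mat"
  assumes S: "S \<in> carrier_mat n n" and c: "c \<noteq> 0" and cb: "c + of_nat n * b \<noteq> 0"
    and T: "T = of_int (int n - 2) \<cdot>\<^sub>m 1\<^sub>m n + all_ones_mat n - S"
  defines "y \<equiv> - b / (c * (c + of_nat n * b))"
  shows "det (1\<^sub>m n + (c \<cdot>\<^sub>m 1\<^sub>m n + b \<cdot>\<^sub>m all_ones_mat n) * S) =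
    det (c \<cdot>\<^sub>m 1\<^sub>m n + b \<cdot>\<^sub>m all_ones_mat n) *
      ((1 + y) * ((- 1) ^ n * poly (char_poly S) (- 1 / c)) -
       y * poly (char_poly T) (1 / c + of_int (int n - 2)))"
proof -
  let ?J = "all_ones_mat n :: 'a mat"
  let ?K = "c \<cdot>\<^sub>m 1\<^sub>m n + b \<cdot>\<^sub>m ?J"
  let ?P = "(1 / c) \<cdot>\<^sub>m 1\<^sub>m n + S"
  have JJ: "?J * ?J = of_nat n \<cdot>\<^sub>m ?J"
    by (intro eq_matI) (auto simp: scalar_prod_def)
  \<comment> \<open>Because \<open>J J = n J\<close>, the product is a combination of
    \<open>I\<close> and \<open>J\<close>; \<open>y\<close> is chosen to cancel the coefficient of
    \<open>J\<close>, which is \<open>b / c + y (c + n b)\<close>.\<close>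
  have Kinv: "?K * ((1 / c) \<cdot>\<^sub>m 1\<^sub>m n + y \<cdot>\<^sub>m ?J) = 1\<^sub>m n"
  proof -
    have "?K * ((1 / c) \<cdot>\<^sub>m 1\<^sub>m n + y \<cdot>\<^sub>m ?J) =
        ?K * ((1 / c) \<cdot>\<^sub>m 1\<^sub>m n) + ?K * (y \<cdot>\<^sub>m ?J)"
      by (rule mult_add_distrib_mat) auto
    also have "?K * ((1 / c) \<cdot>\<^sub>m 1\<^sub>m n) = (1 / c) \<cdot>\<^sub>m ?K"
      by (subst mult_smult_distrib[of _ n n _ n]) auto
    also have "?K * (y \<cdot>\<^sub>m ?J) = y \<cdot>\<^sub>m (?K * ?J)"
      by (rule mult_smult_distrib) auto
    also have "?K * ?J = c \<cdot>\<^sub>m ?J + (b * of_nat n) \<cdot>\<^sub>m ?J"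
      by (subst add_mult_distrib_mat[of _ n n _ _ n])
        (auto simp: JJ mult_smult_assoc_mat[of _ n n _ n] intro!: eq_matI)
    also have "(1 / c) \<cdot>\<^sub>m ?K + y \<cdot>\<^sub>m (c \<cdot>\<^sub>m ?J + (b * of_nat n) \<cdot>\<^sub>m ?J) = 1\<^sub>m n"
    proof (rule eq_matI, goal_cases)
      case (1 i j)
      have "b / c + y * (c + b * of_nat n) = 0"
        unfolding y_def mult.commute[of b] using c cb by simp
      then show ?case
        using 1 c by (auto simp: field_simps)
    qed auto
    finally show ?thesis .
  qed
  have "?K * (?P + y \<cdot>\<^sub>m ?J) = ?K * (((1 / c) \<cdot>\<^sub>m 1\<^sub>m n + y \<cdot>\<^sub>m ?J) + S)"
    using S by (intro arg_cong[where f = "\<lambda>M. ?K * M"]) (auto intro!: eq_matI)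
  also have "\<dots> = ?K * ((1 / c) \<cdot>\<^sub>m 1\<^sub>m n + y \<cdot>\<^sub>m ?J) + ?K * S"
    by (rule mult_add_distrib_mat) (use S in auto)
  finally have "1\<^sub>m n + ?K * S = ?K * (?P + y \<cdot>\<^sub>m ?J)"
    by (simp add: Kinv)
  then have "det (1\<^sub>m n + ?K * S) = det ?K * det (?P + y \<cdot>\<^sub>m ?J)"
    using S by (simp add: det_mult[of _ n])
  also have "det (?P + y \<cdot>\<^sub>m ?J) = (1 + y) * det ?P - y * det (?P - ?J)"
    by (rule det_add_smult_all_ones) (use S in auto)
  also have "?P = (-1) \<cdot>\<^sub>m ((- 1 / c) \<cdot>\<^sub>m 1\<^sub>m n - S)"
    using S by (auto intro!: eq_matI)
  also have "det \<dots> = (- 1) ^ n * poly (char_poly S) (- 1 / c)"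
    using S by (simp add: poly_char_poly[OF S])
  \<comment> \<open>The value at \<open>y = -1\<close>: subtracting \<open>J\<close> gives the
    characteristic matrix of \<open>T\<close>, with the argument shifted by
    \<open>n - 2\<close>.\<close>
  also have "(-1) \<cdot>\<^sub>m ((- 1 / c) \<cdot>\<^sub>m 1\<^sub>m n - S) - ?J =
      (1 / c + of_int (int n - 2)) \<cdot>\<^sub>m 1\<^sub>m n - T"
    using S by (auto simp: T intro!: eq_matI)
  also have "det \<dots> = poly (char_poly T) (1 / c + of_int (int n - 2))"
    by (rule poly_char_poly[symmetric]) (use S in \<open>auto simp: T\<close>)
  finally show ?thesis .
qed

subsection \<open>Walks and the resolvent\<close>

text \<open>Indexed by vertices instead of positions, so that the walk recursion and the resolvent
  equation are sums over \<open>pverts G\<close> and involve no enumeration.\<close>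

definition adj :: "'a pair_pre_digraph \<Rightarrow> 'a \<Rightarrow> 'a \<Rightarrow> real" where
  "adj G u v = (if (u, v) \<in> parcs G then 1 else 0)"

lemma finite_walks:
  assumes "pair_graph G"
  shows "finite {p. pre_digraph.awalk (with_proj G) u p v \<and> length p = k}"
proof -
  interpret pair_graph G by fact
  show ?thesis
    by (rule finite_subset[OF _ finite_lists_length_eq[OF pair_finite_arcs, of k]])
      (auto simp: pre_digraph.awalk_def)
qed

lemma num_walks_0:
  assumes "u \<in> pverts G"
  shows "num_walks G 0 u v = (if u = v then 1 else 0)"
proof -
  have "{p. pre_digraph.awalk (with_proj G) u p v \<and> length p = 0} = (if u = v then {[]} else {})"
    using assms by (auto simp: pre_digraph.awalk_def pre_digraph.cas.simps)
  then show ?thesis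
    by (simp add: num_walks_def)
qed

text \<open>A nonempty walk splits uniquely into its first arc and a shorter walk. Iterated, this
  identifies walk counts with entries of powers of the adjacency matrix.\<close>

lemma num_walks_Suc:
  assumes "pair_graph G"
  shows "real (num_walks G (Suc k) u v) = (\<Sum>w\<in>pverts G. adj G u w * real (num_walks G k w v))"
proof -
  interpret pair_graph G by fact
  define P where "P k u = {p. pre_digraph.awalk (with_proj G) u p v \<and> length p = k}" for k u
  define W where "W = {w \<in> pverts G. (u, w) \<in> parcs G}"
  have fin: "finite (P k u)" for k u
    unfolding P_def by (rule finite_walks[OF assms])
  have "P (Suc k) u = (\<Union>w\<in>W. (#) (u, w) ` P k w)"
  proof -
    have "e # p \<in> P (Suc k) u \<longleftrightarrow> (\<exists>w\<in>W. e = (u, w) \<and> p \<in> P k w)" for e p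
      by (cases e) (auto simp: P_def W_def awalk_Cons_iff dest: in_arcsD2)
    moreover have "[] \<notin> P (Suc k) u"
      by (simp add: P_def)
    ultimately have "p \<in> P (Suc k) u \<longleftrightarrow> p \<in> (\<Union>w\<in>W. (#) (u, w) ` P k w)" for p
      by (cases p) auto
    then show ?thesis
      by blast
  qed
  also have "card \<dots> = (\<Sum>w\<in>W. card ((#) (u, w) ` P k w))"
    by (rule card_UN_disjoint) (auto simp: W_def pair_finite_verts fin)
  also have "\<dots> = (\<Sum>w\<in>W. card (P k w))"
    by (intro sum.cong card_image) auto
  finally have "real (num_walks G (Suc k) u v) = (\<Sum>w\<in>W. real (num_walks G k w v))"
    by (simp add: P_def num_walks_def)
  also have "\<dots> = (\<Sum>w\<in>pverts G. adj G u w * real (num_walks G k w v))"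
    by (rule sum.mono_neutral_cong_left) (auto simp: W_def adj_def pair_finite_verts)
  finally show ?thesis .
qed

lemma out_degree_eq_sum_adj:
  assumes "pair_graph G"
  shows "real (out_degree (with_proj G) u) = (\<Sum>w\<in>pverts G. adj G u w)"
proof -
  interpret pair_graph G by fact
  have "out_arcs (with_proj G) u = Pair u ` {w \<in> pverts G. (u, w) \<in> parcs G}"
    by (auto simp: out_arcs_def in_arcsD2)
  then have "out_degree (with_proj G) u = card {w \<in> pverts G. (u, w) \<in> parcs G}"
    unfolding out_degree_def by (simp add: card_image inj_on_def)
  also have "real \<dots> = (\<Sum>w\<in>pverts G. adj G u w)"
    by (simp add: adj_def sum.If_cases pair_finite_verts Int_def)
  finally show ?thesis .
qed

lemma adj_commute:
  assumes "pair_graph G"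
  shows "adj G u v = adj G v u"
proof -
  interpret pair_graph G by fact
  show ?thesis
    by (auto simp: adj_def dest: arcs_symmetric)
qed

section \<open>Regularity and the Neumann series\<close>

text \<open>A closed walk of length 2 leaves along an arc and returns along its reverse, so there
  are as many of them at \<open>u\<close> as arcs out of \<open>u\<close>.\<close>

lemma one_walk_regular_imp_regular:
  assumes G: "pair_graph G" and "one_walk_regular G"
  obtains d where "\<And>u. u \<in> pverts G \<Longrightarrow> out_degree (with_proj G) u = d"
proof -
  interpret pair_graph G by fact
  have "real (num_walks G 2 u u) = real (out_degree (with_proj G) u)" if "u \<in> pverts G" for u
  proof -
    have "real (num_walks G (Suc 0) w u) = adj G w u" if "w \<in> pverts G" for w
    proof -
      have "real (num_walks G (Suc 0) w u) = (\<Sum>x\<in>pverts G. if x = u then adj G w x else 0)"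
        unfolding num_walks_Suc[OF G] by (rule sum.cong) (auto simp: num_walks_0)
      then show ?thesis
        using \<open>u \<in> pverts G\<close> by (simp add: pair_finite_verts)
    qed
    then have "real (num_walks G 2 u u) = (\<Sum>w\<in>pverts G. adj G u w * adj G w u)"
      by (simp add: numeral_2_eq_2 num_walks_Suc[OF G, of "Suc 0"])
    \<comment> \<open>By symmetry of the arcs the two 0/1 factors agree, so their product is either
      one of them.\<close>
    also have "\<dots> = (\<Sum>w\<in>pverts G. adj G u w)"
      by (rule sum.cong) (auto simp: adj_def dest: arcs_symmetric)
    finally show ?thesis
      by (simp add: out_degree_eq_sum_adj[OF G])
  qed
  moreover have "num_walks G 2 u u = num_walks G 2 v v" if "u \<in> pverts G" "v \<in> pverts G" for u v
    using assms(2) that pos2 unfolding one_walk_regular_def by blast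
  ultimately have eq: "out_degree (with_proj G) u = out_degree (with_proj G) v"
    if "u \<in> pverts G" "v \<in> pverts G" for u v
    using that by (metis of_nat_eq_iff)
  show thesis
  proof (cases "pverts G = {}")
    case False
    then show thesis
      using eq that by blast
  qed (use that in blast)
qed

text \<open>Each step offers at most \<open>card (pverts G)\<close> choices. This crude geometric
  bound is enough for the Neumann series to converge for large \<open>s\<close>.\<close>

lemma num_walks_le:
  assumes G: "pair_graph G" and "u \<in> pverts G"
  shows "real (num_walks G k u v) \<le> real (card (pverts G)) ^ k"
  using assms(2)
proof (induction k arbitrary: u)
  case 0
  then show ?case by (simp add: num_walks_0)
next
  case (Suc k)
  have "real (num_walks G (Suc k) u v) \<le> (\<Sum>w\<in>pverts G. real (card (pverts G)) ^ k)"
    unfolding num_walks_Suc[OF G] by (rule sum_mono) (use Suc.IH in \<open>auto simp: adj_def\<close>)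
  then show ?case
    by simp
qed

text \<open>\<open>N\<close> is the Neumann series of the inverse of
  \<open>s I - \<sigma> A\<close>. Its terms are multiples of walk counts, hence constant on the
  diagonal and on arcs, and so is the sum. The last conclusion, used at \<open>0\<close> and at the
  order \<open>m\<close> of the deleted graph, makes the clique block
  \<open>(\<alpha> - \<beta>) I + \<beta> J\<close> invertible: for large \<open>s\<close>,
  \<open>\<alpha>\<close> is close to \<open>1 / s\<close> and \<open>\<beta>\<close> is negligible
  against it.\<close>

lemma resolvent_one_walk_regular:
  fixes \<sigma> s :: real
  assumes G: "pair_graph G" and reg: "one_walk_regular G" and \<sigma>: "\<bar>\<sigma>\<bar> \<le> 1"
  defines "n \<equiv> card (pverts G)"
  assumes s: "s > real (n * (n + 3))"
  obtains N \<alpha> \<beta> where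
    "\<And>u v. u \<in> pverts G \<Longrightarrow>
       s * N u v - \<sigma> * (\<Sum>w\<in>pverts G. adj G u w * N w v) = (if u = v then 1 else 0)"
    "\<And>u. u \<in> pverts G \<Longrightarrow> N u u = \<alpha>"
    "\<And>u v. (u, v) \<in> parcs G \<Longrightarrow> N u v = \<beta>"
    "\<And>m. m \<le> n \<Longrightarrow> \<alpha> - \<beta> + real m * \<beta> \<noteq> 0"
proof -
  interpret pair_graph G by fact
  define W where "W k u v = real (num_walks G k u v)" for k u v
  define f where "f u v k = \<sigma> ^ k * W k u v / s ^ Suc k" for u v k
  define N where "N u v = suminf (f u v)" for u v
  \<comment> \<open>The terms are dominated by \<open>(1 / s) q ^ k\<close>; \<open>e\<close> is the
    sum of this majorant from \<open>k = 1\<close> on, and so bounds the distance of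
    \<open>N\<close> from its leading term \<open>(1 / s) I\<close>.\<close>
  define q where "q = real n / s"
  define e where "e = (1 / s) * (q / (1 - q))"
  have ns: "real n * 3 \<le> real (n * (n + 3))"
    by (simp add: algebra_simps)
  have s0: "s > 0" using s by (meson less_le_trans of_nat_0_le_iff le_less_trans)
  have sn: "s > real n" using s ns by linarith
  have q: "0 \<le> q" "q < 1"
    using s0 sn by (simp_all add: q_def)
  have f_le: "\<bar>f u v k\<bar> \<le> (1 / s) * q ^ k" if "u \<in> pverts G" for u v k
  proof -
    have "\<bar>\<sigma> ^ k * W k u v\<bar> \<le> 1 * real n ^ k"
      unfolding abs_mult using num_walks_le[OF G that, of k v] \<sigma>
      by (intro mult_mono) (auto simp: W_def n_def power_abs power_le_one)
    then show ?thesis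
      using s0 by (simp add: f_def q_def power_divide divide_simps)
  qed
  have geo: "(\<lambda>k. (1 / s) * q ^ k) sums ((1 / s) * (1 / (1 - q)))"
    using q by (intro sums_mult geometric_sums) simp
  have summable: "summable (f u v)" if "u \<in> pverts G" for u v
    by (rule summable_comparison_test[OF _ sums_summable[OF geo]]) (use f_le[OF that] in auto)
  have f0: "f u v 0 = (if u = v then 1 / s else 0)" if "u \<in> pverts G" for u v
    using that by (simp add: f_def W_def num_walks_0)
  have near: "\<bar>N u v - (if u = v then 1 / s else 0)\<bar> \<le> e" if u: "u \<in> pverts G" for u v
  proof -
    have tail: "(\<lambda>k. (1 / s) * q ^ Suc k) sums e"
      using sums_mult[OF geometric_sums[of q], of "(1 / s) * q"] q by (simp add: e_def mult_ac)
    have "N u v - (if u = v then 1 / s else 0) = (\<Sum>k. f u v (Suc k))"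
      using suminf_split_head[OF summable[OF u]] f0[OF u] by (simp add: N_def)
    also have "\<bar>\<dots>\<bar> \<le> (\<Sum>k. (1 / s) * q ^ Suc k)"
      unfolding real_norm_def[symmetric]
      by (rule norm_suminf_le) (use f_le[OF u] tail in \<open>auto simp del: power_Suc simp: sums_iff\<close>)
    finally show ?thesis
      using tail by (simp add: sums_iff)
  qed
  have resolvent: "s * N u v - \<sigma> * (\<Sum>w\<in>pverts G. adj G u w * N w v) = (if u = v then 1 else 0)"
    if u: "u \<in> pverts G" for u v
  proof -
    \<comment> \<open>The walk recursion, read termwise: multiplying by \<open>s\<close> shifts the
      series by one place, and the shifted term is \<sigma> times the adjacency operator applied to
      the old one. Summation gives \<open>s (N - I / s) = \<sigma> A N\<close>.\<close>
    have "s * f u v (Suc k) = \<sigma> * (\<Sum>w\<in>pverts G. adj G u w * f w v k)" for k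
    proof -
      have "s * f u v (Suc k) = \<sigma> * (\<sigma> ^ k / s ^ Suc k * W (Suc k) u v)"
        using s0 by (simp add: f_def field_simps)
      also have "\<sigma> ^ k / s ^ Suc k * W (Suc k) u v = (\<Sum>w\<in>pverts G. adj G u w * f w v k)"
        unfolding W_def num_walks_Suc[OF G] f_def sum_distrib_left by (rule sum.cong) auto
      finally show ?thesis .
    qed
    moreover have "(\<lambda>k. \<sigma> * (\<Sum>w\<in>pverts G. adj G u w * f w v k)) sums
        (\<sigma> * (\<Sum>w\<in>pverts G. adj G u w * N w v))"
      unfolding N_def by (intro sums_mult sums_sum summable_sums summable)
    ultimately have "(\<lambda>k. s * f u v (Suc k)) sums (\<sigma> * (\<Sum>w\<in>pverts G. adj G u w * N w v))"
      by simp
    moreover have "(\<lambda>k. s * f u v (Suc k)) sums (s * (N u v - f u v 0))"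
      unfolding N_def using summable[OF u] by (intro sums_mult) (simp add: sums_Suc_iff summable_sums)
    ultimately have "\<sigma> * (\<Sum>w\<in>pverts G. adj G u w * N w v) = s * (N u v - f u v 0)"
      by (rule sums_unique2)
    then show ?thesis
      using s0 f0[OF u, of v] by (auto simp: algebra_simps split: if_splits)
  qed
  \<comment> \<open>1-walk regularity speaks of positive lengths only. At length 0 every closed
    count is 1.\<close>
  have diag: "f u u = f v v" if "u \<in> pverts G" "v \<in> pverts G" for u v
  proof
    fix k
    have "num_walks G k u u = num_walks G k v v"
    proof (cases "k = 0")
      case True
      then show ?thesis
        using that by (simp add: num_walks_0)
    next
      case False
      then show ?thesis
        using reg that unfolding one_walk_regular_def by blast
    qed
    then show "f u u k = f v v k"
      by (simp add: f_def W_def)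
  qed
  \<comment> \<open>At length 0 the count between the ends of an arc is 0, because there are no
    loops.\<close>
  have arcs: "f u v = f x y" if "(u, v) \<in> parcs G" "(x, y) \<in> parcs G" for u v x y
  proof
    fix k
    have "num_walks G k u v = num_walks G k x y"
    proof (cases "k = 0")
      case True
      then show ?thesis
        using that no_loops' by (auto simp: num_walks_0 in_arcsD1)
    next
      case False
      then show ?thesis
        using reg that unfolding one_walk_regular_def by blast
    qed
    then show "f u v k = f x y k"
      by (simp add: f_def W_def)
  qed
  \<comment> \<open>With no vertices the value is unconstrained, but the estimate must still hold;
    \<open>1 / s\<close> satisfies it. Likewise \<beta> is set to 0 when there are no arcs.\<close>
  obtain \<alpha> where \<alpha>: "\<And>u. u \<in> pverts G \<Longrightarrow> N u u = \<alpha>" "\<bar>\<alpha> - 1 / s\<bar> \<le> e"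
  proof (cases "pverts G = {}")
    case True
    then show thesis
      using q s0 by (intro that[of "1 / s"]) (auto simp: e_def)
  next
    case False
    then obtain u where u: "u \<in> pverts G" by auto
    show thesis
    proof (rule that)
      show "N v v = N u u" if "v \<in> pverts G" for v
        unfolding N_def diag[OF that u] ..
      show "\<bar>N u u - 1 / s\<bar> \<le> e"
        using near[OF u, of u] by simp
    qed
  qed
  obtain \<beta> where \<beta>: "\<And>u v. (u, v) \<in> parcs G \<Longrightarrow> N u v = \<beta>" "\<bar>\<beta>\<bar> \<le> e"
  proof (cases "parcs G = {}")
    case True
    then show thesis
      using q s0 by (intro that[of 0]) (auto simp: e_def)
  next
    case False
    then obtain u v where uv: "(u, v) \<in> parcs G" by auto
    show thesis
    proof (rule that)
      show "N x y = N u v" if "(x, y) \<in> parcs G" for x y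
        unfolding N_def arcs[OF that uv] ..
      show "\<bar>N u v\<bar> \<le> e"
        using near[OF in_arcsD1[OF uv], of v] uv no_loops' by auto
    qed
  qed
  \<comment> \<open>This is where the threshold on \<open>s\<close> comes from: with
    \<open>q = n / s\<close>, the inequality \<open>(n + 2) q < 1 - q\<close> says exactly
    \<open>n (n + 3) < s\<close>.\<close>
  have small: "(real n + 2) * e < 1 / s"
  proof -
    have "real n * (real n + 3) / s < 1"
      using s s0 by simp
    then have "(real n + 2) * q < 1 - q"
      by (simp add: q_def algebra_simps add_divide_distrib)
    then have "(real n + 2) * (q / (1 - q)) < 1"
      using q by (simp add: field_simps)
    then have "(1 / s) * ((real n + 2) * (q / (1 - q))) < (1 / s) * 1"
      using s0 by (intro mult_strict_left_mono) auto
    then show ?thesis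
      by (simp add: e_def mult_ac)
  qed
  \<comment> \<open>If the expression vanished, then \<open>\<alpha> = (1 - m) \<beta>\<close> would
    be at most \<open>(n + 1) e\<close> in absolute value, while it is at least
    \<open>1 / s - e\<close>.\<close>
  have "\<alpha> - \<beta> + real m * \<beta> \<noteq> 0" if "m \<le> n" for m
  proof
    assume "\<alpha> - \<beta> + real m * \<beta> = 0"
    then have "\<alpha> = (1 - real m) * \<beta>" by (simp add: algebra_simps)
    then have "\<bar>\<alpha>\<bar> = \<bar>1 - real m\<bar> * \<bar>\<beta>\<bar>" by (simp add: abs_mult)
    also have "\<dots> \<le> (real n + 1) * e"
      using that \<beta>(2) by (intro mult_mono) auto
    finally have "\<bar>\<alpha>\<bar> \<le> (real n + 1) * e" .
    then have "1 / s \<le> (real n + 1) * e + e"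
      using \<alpha>(2) by linarith
    then show False
      using small by (simp add: algebra_simps)
  qed
  then show thesis
    using that[of N \<alpha> \<beta>] resolvent \<alpha>(1) \<beta>(1) by blast
qed

subsection \<open>Deleting a copy of a graph\<close>

text \<open>Keeping the vertex kernel apart from the enumeration lets the same kernel be tabulated
  along a list that puts the clique first.\<close>

definition mat_on :: "'a list \<Rightarrow> ('a \<Rightarrow> 'a \<Rightarrow> 'b) \<Rightarrow> 'b mat" where
  "mat_on xs f = mat (length xs) (length xs) (\<lambda>(i, j). f (xs ! i) (xs ! j))"

lemma mat_on_carrier [simp]: "mat_on xs f \<in> carrier_mat (length xs) (length xs)"
  by (simp add: mat_on_def)

lemma mat_on_dim [simp]: "dim_row (mat_on xs f) = length xs" "dim_col (mat_on xs f) = length xs"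
  by (simp_all add: mat_on_def)

lemma mat_on_index [simp]:
  "i < length xs \<Longrightarrow> j < length xs \<Longrightarrow> mat_on xs f $$ (i, j) = f (xs ! i) (xs ! j)"
  by (simp add: mat_on_def)

lemma char_poly_mat_on_cong_set:
  fixes f :: "'a \<Rightarrow> 'a \<Rightarrow> 'b :: comm_ring_1"
  assumes "distinct xs" "distinct ys" "set xs = set ys"
  shows "char_poly (mat_on xs f) = char_poly (mat_on ys f)"
  using char_poly_reindex[OF assms] by (simp add: mat_on_def)

lemma mat_on_mult_index:
  fixes f g :: "'a \<Rightarrow> 'a \<Rightarrow> 'b :: semiring_0"
  assumes "distinct xs" "i < length xs" "j < length xs"
  shows "(mat_on xs f * mat_on xs g) $$ (i, j) = (\<Sum>w\<in>set xs. f (xs ! i) w * g w (xs ! j))"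
proof -
  have "(mat_on xs f * mat_on xs g) $$ (i, j) =
      (\<Sum>k = 0..<length xs. f (xs ! i) (xs ! k) * g (xs ! k) (xs ! j))"
    using assms(2,3) by (simp add: scalar_prod_def)
  also have "\<dots> = (\<Sum>w\<in>set xs. f (xs ! i) w * g w (xs ! j))"
    by (rule sum.reindex_bij_betw) (use assms(1) in \<open>auto intro!: bij_betw_nth\<close>)
  finally show ?thesis .
qed

section \<open>The effect of deletion on the Laplacians\<close>

text \<open>One parameter covers both claims: the value \<open>-1\<close> gives the Laplacian and
  \<open>1\<close> the unsigned Laplacian.\<close>

definition signed_laplacian :: "real \<Rightarrow> 'a pair_pre_digraph \<Rightarrow> 'a \<Rightarrow> 'a \<Rightarrow> real" where
  "signed_laplacian \<sigma> G u v =
     (if u = v then real (out_degree (with_proj G) u) else 0) + \<sigma> * adj G u v"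

lemma laplacian_mat_eq:
  "distinct xs \<Longrightarrow> laplacian_mat xs G = mat_on xs (signed_laplacian (-1) G)"
  by (intro eq_matI) (auto simp: laplacian_mat_def degree_mat_def adjacency_mat_def
      signed_laplacian_def adj_def nth_eq_iff_index_eq)

lemma unsigned_laplacian_mat_eq:
  "distinct xs \<Longrightarrow> unsigned_laplacian_mat xs G = mat_on xs (signed_laplacian 1 G)"
  by (intro eq_matI) (auto simp: unsigned_laplacian_mat_def degree_mat_def adjacency_mat_def
      signed_laplacian_def adj_def nth_eq_iff_index_eq)

text \<open>Since the image is a clique, every arc of the copy is present in \<open>X\<close> and is
  really removed; since \<iota> is injective, the arcs removed at \<open>\<iota> a\<close>
  correspond one to one to the arcs of \<open>Y\<close> at \<open>a\<close>. Hence degrees and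
  adjacencies both drop by those of \<open>Y\<close>.\<close>

lemma signed_laplacian_delete_copy:
  assumes X: "pair_graph X" and Y: "pair_graph Y"
    and inj: "inj_on \<iota> (pverts Y)" and clique: "clique X (\<iota> ` pverts Y)"
    and ab: "a \<in> pverts Y" "b \<in> pverts Y"
  shows "signed_laplacian \<sigma> (delete_copy X Y \<iota>) (\<iota> a) (\<iota> b) =
    signed_laplacian \<sigma> X (\<iota> a) (\<iota> b) - signed_laplacian \<sigma> Y a b"
proof -
  interpret X: pair_graph X by fact
  interpret Y: pair_graph Y by fact
  have arc_iff: "(\<iota> x, \<iota> y) \<in> {(\<iota> a, \<iota> b) |a b. (a, b) \<in> parcs Y} \<longleftrightarrow> (x, y) \<in> parcs Y"
    if "x \<in> pverts Y" "y \<in> pverts Y" for x y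
    using that inj by (auto dest: Y.in_arcsD1 Y.in_arcsD2 inj_onD)
  have arc_X: "(\<iota> x, \<iota> y) \<in> parcs X" if "(x, y) \<in> parcs Y" for x y
  proof -
    have "x \<in> pverts Y" "y \<in> pverts Y" "x \<noteq> y"
      using that Y.no_loops' by (auto dest: Y.in_arcsD1 Y.in_arcsD2)
    then show ?thesis
      using clique inj by (auto simp: clique_def inj_on_eq_iff)
  qed
  have adj: "adj (delete_copy X Y \<iota>) (\<iota> a) (\<iota> b) = adj X (\<iota> a) (\<iota> b) - adj Y a b"
    using arc_iff[OF ab] arc_X by (auto simp: adj_def delete_copy_def)
  let ?im = "map_prod \<iota> \<iota> ` out_arcs (with_proj Y) a"
  have out: "out_arcs (with_proj (delete_copy X Y \<iota>)) (\<iota> a) = out_arcs (with_proj X) (\<iota> a) - ?im"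
    using inj ab(1) by (force simp: out_arcs_def delete_copy_def dest: Y.in_arcsD1 inj_onD)
  have sub: "?im \<subseteq> out_arcs (with_proj X) (\<iota> a)"
    using arc_X by (auto simp: out_arcs_def)
  have fin: "finite (out_arcs (with_proj X) (\<iota> a))"
    by (auto simp: out_arcs_def X.pair_finite_arcs)
  have "inj_on (map_prod \<iota> \<iota>) (out_arcs (with_proj Y) a)"
    by (rule inj_on_subset[OF map_prod_inj_on[OF inj inj]])
      (auto simp: out_arcs_def Y.in_arcsD1 Y.in_arcsD2)
  then have "card ?im = out_degree (with_proj Y) a"
    by (simp add: card_image out_degree_def)
  then have "real (out_degree (with_proj (delete_copy X Y \<iota>)) (\<iota> a)) =
      real (out_degree (with_proj X) (\<iota> a)) - real (out_degree (with_proj Y) a)"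
    using card_mono[OF fin sub] fin finite_subset[OF sub fin]
    unfolding out_degree_def out by (simp add: card_Diff_subset[OF _ sub] of_nat_diff)
  moreover have "\<iota> a = \<iota> b \<longleftrightarrow> a = b"
    using inj ab by (simp add: inj_on_eq_iff)
  ultimately show ?thesis
    by (auto simp: signed_laplacian_def adj algebra_simps)
qed

text \<open>Both ends of a deleted arc lie in the image of \<iota>, so neither adjacencies nor
  degrees change elsewhere.\<close>

lemma signed_laplacian_delete_copy_outside:
  assumes Y: "pair_graph Y" and uv: "u \<notin> \<iota> ` pverts Y \<or> v \<notin> \<iota> ` pverts Y"
  shows "signed_laplacian \<sigma> (delete_copy X Y \<iota>) u v = signed_laplacian \<sigma> X u v"
proof -
  interpret Y: pair_graph Y by fact
  have "adj (delete_copy X Y \<iota>) u v = adj X u v"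
    using uv by (auto simp: adj_def delete_copy_def dest: Y.in_arcsD1 Y.in_arcsD2)
  moreover have "out_arcs (with_proj (delete_copy X Y \<iota>)) u = out_arcs (with_proj X) u" if "u = v"
    using uv that by (auto simp: out_arcs_def delete_copy_def dest: Y.in_arcsD1)
  ultimately show ?thesis
    by (auto simp: signed_laplacian_def out_degree_def)
qed

text \<open>\<open>N\<close> inverts the characteristic matrix of \<open>X\<close> at
  \<open>t\<close>, and deletion adds the signed Laplacian of \<open>Y\<close> to its clique block.
  The corner formula applies; the corner of \<open>N\<close> has \<alpha> on the diagonal and
  \<beta> off it, as distinct clique vertices are adjacent.\<close>

lemma poly_char_poly_delete_copy:
  fixes t \<sigma> \<alpha> \<beta> :: real
  assumes X: "pair_graph X" and Y: "pair_graph Y"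
    and inj: "inj_on \<iota> (pverts Y)" and clique: "clique X (\<iota> ` pverts Y)"
    and N: "\<And>u v. u \<in> pverts X \<Longrightarrow> v \<in> pverts X \<Longrightarrow>
      (\<Sum>w\<in>pverts X. ((if u = w then t else 0) - signed_laplacian \<sigma> X u w) * N w v) = (if u = v then 1 else 0)"
    and N_diag: "\<And>u. u \<in> pverts X \<Longrightarrow> N u u = \<alpha>"
    and N_arc: "\<And>u v. (u, v) \<in> parcs X \<Longrightarrow> N u v = \<beta>"
    and xs: "distinct xs" "set xs = pverts X" and ys: "distinct ys" "set ys = pverts Y"
  shows "poly (char_poly (mat_on xs (signed_laplacian \<sigma> (delete_copy X Y \<iota>)))) t =
    poly (char_poly (mat_on xs (signed_laplacian \<sigma> X))) t *
    det (1\<^sub>m (length ys) + ((\<alpha> - \<beta>) \<cdot>\<^sub>m 1\<^sub>m (length ys) + \<beta> \<cdot>\<^sub>m all_ones_mat (length ys)) *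
      mat_on ys (signed_laplacian \<sigma> Y))"
proof -
  interpret X: pair_graph X by fact
  interpret Y: pair_graph Y by fact
  have sub: "\<iota> ` pverts Y \<subseteq> pverts X"
    using clique by (simp add: clique_def)
  obtain zs where zs: "set zs = pverts X - \<iota> ` pverts Y" "distinct zs"
    using finite_distinct_list[of "pverts X - \<iota> ` pverts Y"] X.pair_finite_verts by auto
  \<comment> \<open>The clique comes first, in the order of \<open>ys\<close>, so that the change
    caused by deletion fills exactly the leading block of size \<open>m\<close>.\<close>
  define vs where "vs = map \<iota> ys @ zs"
  define m where "m = length ys"
  define k where "k = length zs"
  have vs: "distinct vs" "set vs = pverts X"
    using ys zs inj sub by (auto simp: vs_def distinct_map)
  have len: "length vs = m + k"
    by (simp add: vs_def m_def k_def)
  have vs_lo: "vs ! i = \<iota> (ys ! i)" if "i < m" for i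
    using that by (simp add: vs_def m_def nth_append)
  have vs_hi: "vs ! i \<notin> \<iota> ` pverts Y" if "\<not> i < m" "i < m + k" for i
  proof -
    have "vs ! i = zs ! (i - m)" "i - m < length zs"
      using that by (auto simp: vs_def m_def k_def nth_append)
    then show ?thesis
      using zs(1) nth_mem[of "i - m" zs] by auto
  qed
  have ys_mem: "ys ! i \<in> pverts Y" if "i < m" for i
    using that ys(2) nth_mem[of i ys] by (simp add: m_def)
  have vs_mem: "vs ! i \<in> pverts X" if "i < m + k" for i
    using that vs(2) nth_mem[of i vs] by (simp add: len)
  have vs_eq: "vs ! i = vs ! j \<longleftrightarrow> i = j" if "i < m + k" "j < m + k" for i j
    using that vs(1) len by (simp add: nth_eq_iff_index_eq)
  define g where "g u w = (if u = w then t else 0) - signed_laplacian \<sigma> X u w" for u w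
  let ?S = "mat_on ys (signed_laplacian \<sigma> Y)"
  let ?M = "mat_on vs g"
  let ?SS = "four_block_mat ?S (0\<^sub>m m k) (0\<^sub>m k m) (0\<^sub>m k k)"
  have S: "?S \<in> carrier_mat m m" and M: "?M \<in> carrier_mat (m + k) (m + k)"
    using mat_on_carrier[of ys] mat_on_carrier[of vs] by (simp_all add: m_def len)
  have M_eq: "t \<cdot>\<^sub>m 1\<^sub>m (m + k) - mat_on vs (signed_laplacian \<sigma> X) = ?M"
    by (intro eq_matI) (auto simp: g_def len vs_eq)
  have "t \<cdot>\<^sub>m 1\<^sub>m (m + k) - mat_on vs (signed_laplacian \<sigma> (delete_copy X Y \<iota>)) = ?M + ?SS"
  proof (rule eq_matI, goal_cases)
    case (1 i j)
    then have ij: "i < m + k" "j < m + k"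
      using S by auto
    show ?case
    proof (cases "i < m \<and> j < m")
      case True
      then show ?thesis
        using ij S signed_laplacian_delete_copy[OF X Y inj clique ys_mem ys_mem, of i j \<sigma>]
        by (simp add: len g_def vs_lo[symmetric] vs_eq flip: m_def)
    next
      case False
      then have "vs ! i \<notin> \<iota> ` pverts Y \<or> vs ! j \<notin> \<iota> ` pverts Y"
        using ij vs_hi by blast
      then have "signed_laplacian \<sigma> (delete_copy X Y \<iota>) (vs ! i) (vs ! j) =
          signed_laplacian \<sigma> X (vs ! i) (vs ! j)"
        by (rule signed_laplacian_delete_copy_outside[OF Y])
      then show ?thesis
        using ij S False by (auto simp add: len g_def vs_eq simp flip: m_def)
    qed
  qed (use S M in \<open>auto simp: len\<close>)
  moreover have "det (?M + ?SS) =
    det ?M * det (1\<^sub>m m + ((\<alpha> - \<beta>) \<cdot>\<^sub>m 1\<^sub>m m + \<beta> \<cdot>\<^sub>m all_ones_mat m) * ?S)"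
  proof -
    obtain N1 N2 N3 N4 where split: "split_block (mat_on vs N) m m = (N1, N2, N3, N4)"
      by (metis prod_cases4)
    note blocks = split_block[OF split, of k k, unfolded mat_on_dim, OF len len]
    have "?M * mat_on vs N = 1\<^sub>m (m + k)"
    proof (rule eq_matI, goal_cases)
      case (1 i j)
      then have ij: "i < m + k" "j < m + k" by auto
      have "(?M * mat_on vs N) $$ (i, j) = (\<Sum>w\<in>pverts X. g (vs ! i) w * N w (vs ! j))"
        using mat_on_mult_index[OF vs(1), of i j g N] ij by (simp add: vs(2) len del: index_mult_mat)
      then show ?case
        using ij N[of "vs ! i" "vs ! j"] by (simp add: vs_mem vs_eq g_def del: index_mult_mat)
    qed (simp_all add: len)
    then have "det (?M + ?SS) = det ?M * det (1\<^sub>m m + N1 * ?S)"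
      using det_add_corner[OF M S blocks(1-4)] blocks(5) by simp
    moreover have "N1 = (\<alpha> - \<beta>) \<cdot>\<^sub>m 1\<^sub>m m + \<beta> \<cdot>\<^sub>m all_ones_mat m"
    proof (rule eq_matI, goal_cases)
      case (1 i j)
      then have ij: "i < m" "j < m" by auto
      then have "N1 $$ (i, j) = N (vs ! i) (vs ! j)"
        using split by (auto simp: split_block_def Let_def len)
      moreover have "N (vs ! i) (vs ! j) = (if i = j then \<alpha> else \<beta>)"
      proof (cases "i = j")
        case True
        then show ?thesis using ij N_diag vs_mem by simp
      next
        case False
        then have "(vs ! i, vs ! j) \<in> parcs X"
          using ij clique vs_eq[of i j] by (auto simp: clique_def vs_lo ys_mem)
        then show ?thesis using False N_arc by simp
      qed
      ultimately show ?case
        using ij by simp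
    qed (use blocks in auto)
    ultimately show ?thesis by simp
  qed
  \<comment> \<open>The given enumeration may be exchanged for the adapted one.\<close>
  moreover have "char_poly (mat_on xs f) = char_poly (mat_on vs f)" for f :: "'a \<Rightarrow> 'a \<Rightarrow> real"
    using char_poly_mat_on_cong_set xs vs by metis
  ultimately show ?thesis
    by (simp add: poly_char_poly[of _ "m + k"] M_eq[folded len] flip: m_def len)
qed

section \<open>The clique block and the Laplacians of the deleted graph\<close>

text \<open>The columns of a Laplacian sum to zero, so the all-ones part of the clique block
  annihilates it.\<close>

lemma mult_laplacian_eq_smult:
  assumes Y: "pair_graph Y" and ys: "distinct ys" "set ys = pverts Y"
  defines "m \<equiv> length ys"
  shows "(c \<cdot>\<^sub>m 1\<^sub>m m + b \<cdot>\<^sub>m all_ones_mat m) * mat_on ys (signed_laplacian (-1) Y) =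
    c \<cdot>\<^sub>m mat_on ys (signed_laplacian (-1) Y)"
proof -
  interpret Y: pair_graph Y by fact
  let ?L = "mat_on ys (signed_laplacian (-1) Y)"
  have L: "?L \<in> carrier_mat m m"
    by (simp add: m_def)
  have ones: "all_ones_mat m = mat_on ys (\<lambda>_ _. 1 :: real)"
    by (intro eq_matI) (auto simp: m_def)
  have "(\<Sum>u\<in>pverts Y. signed_laplacian (-1) Y u v) = 0" if "v \<in> pverts Y" for v
  proof -
    have "(\<Sum>u\<in>pverts Y. signed_laplacian (-1) Y u v) =
        (\<Sum>u\<in>pverts Y. if u = v then real (out_degree (with_proj Y) u) else 0) -
        (\<Sum>u\<in>pverts Y. adj Y v u)"
      unfolding signed_laplacian_def by (simp add: sum_subtractf adj_commute[OF Y, of v])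
    then show ?thesis
      using that by (simp add: out_degree_eq_sum_adj[OF Y] Y.pair_finite_verts)
  qed
  then have "all_ones_mat m * ?L = 0\<^sub>m m m"
    unfolding ones ys(2)[symmetric]
    by (intro eq_matI) (auto simp: mat_on_mult_index[OF ys(1)] m_def simp del: index_mult_mat(1))
  moreover have "(c \<cdot>\<^sub>m 1\<^sub>m m + b \<cdot>\<^sub>m all_ones_mat m) * ?L =
      c \<cdot>\<^sub>m 1\<^sub>m m * ?L + b \<cdot>\<^sub>m all_ones_mat m * ?L"
    by (rule add_mult_distrib_mat) (use L in auto)
  ultimately show ?thesis
    using L left_mult_one_mat[OF L] right_add_zero_mat[of "c \<cdot>\<^sub>m ?L" m m]
    by (simp add: mult_smult_assoc_mat[of _ m m _ m])
qed

text \<open>Complementation replaces \<open>A\<close> by \<open>J - I - A\<close> and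
  \<open>D\<close> by \<open>(m - 1) I - D\<close>; adding the two gives the formula.\<close>

lemma unsigned_laplacian_complement:
  assumes Y: "pair_graph Y" and ys: "distinct ys" "set ys = pverts Y"
  defines "m \<equiv> length ys"
  shows "mat_on ys (signed_laplacian 1 (complement Y)) =
    of_int (int m - 2) \<cdot>\<^sub>m 1\<^sub>m m + all_ones_mat m - mat_on ys (signed_laplacian 1 Y)"
proof -
  interpret Y: pair_graph Y by fact
  have card: "card (pverts Y) = m"
    using ys distinct_card m_def by metis
  have adj: "adj (complement Y) u v = (if u = v then 0 else 1) - adj Y u v"
    if "u \<in> pverts Y" "v \<in> pverts Y" for u v
    using that Y.no_loops' by (auto simp: adj_def complement_def)
  have deg: "real (out_degree (with_proj (complement Y)) u) =
      real m - 1 - real (out_degree (with_proj Y) u)" if "u \<in> pverts Y" for u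
  proof -
    have "real (out_degree (with_proj (complement Y)) u) =
        (\<Sum>w\<in>pverts Y. (1 - (if u = w then 1 else 0)) - adj Y u w)"
      unfolding out_degree_eq_sum_adj[OF pair_graph_complement[OF Y]]
      by (rule sum.cong) (auto simp: adj that, auto simp: complement_def)
    then show ?thesis
      using that by (simp add: sum_subtractf out_degree_eq_sum_adj[OF Y] Y.pair_finite_verts card)
  qed
  have "signed_laplacian 1 (complement Y) u v =
      (if u = v then real m - 2 else 0) + 1 - signed_laplacian 1 Y u v"
    if "u \<in> pverts Y" "v \<in> pverts Y" for u v
    using that by (auto simp: signed_laplacian_def adj deg)
  moreover have "ys ! i \<in> pverts Y" if "i < m" for i
    using that ys(2) nth_mem[of i ys] by (simp add: m_def)
  ultimately show ?thesis
    using ys(1) unfolding m_def by (intro eq_matI) (auto simp: nth_eq_iff_index_eq)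
qed

text \<open>A nonzero polynomial has finitely many roots. Hence it suffices to compare
  characteristic polynomials at large arguments, where the Neumann series converges.\<close>

lemma poly_eqI_eventually:
  fixes p q :: "real poly"
  assumes "\<And>t. t > b \<Longrightarrow> poly p t = poly q t"
  shows "p = q"
proof (rule ccontr)
  assume "p \<noteq> q"
  then have "finite {t. poly (p - q) t = 0}"
    by (intro poly_roots_finite) simp
  moreover have "{b<..} \<subseteq> {t. poly (p - q) t = 0}"
    using assms by auto
  ultimately show False
    using finite_subset infinite_Ioi by blast
qed

text \<open>The same \<open>N\<close>, \<alpha> and \<beta> serve both deletions, since they depend
  only on \<open>X\<close> and \<open>t\<close>. The comparison thus reduces to the determinants
  attached to \<open>Y1\<close> and \<open>Y2\<close>, which share their order
  \<open>m\<close>.\<close>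

lemma char_poly_delete_copy_eqI:
  fixes \<sigma> :: real
  assumes X: "pair_graph X" and reg: "one_walk_regular X" and \<sigma>: "\<bar>\<sigma>\<bar> \<le> 1"
    and Y1: "pair_graph Y1" and Y2: "pair_graph Y2"
    and inj1: "inj_on \<iota>1 (pverts Y1)" and clique1: "clique X (\<iota>1 ` pverts Y1)"
    and inj2: "inj_on \<iota>2 (pverts Y2)" and clique2: "clique X (\<iota>2 ` pverts Y2)"
    and xs: "distinct xs" "set xs = pverts X"
    and ys1: "distinct ys1" "set ys1 = pverts Y1" "length ys1 = m"
    and ys2: "distinct ys2" "set ys2 = pverts Y2" "length ys2 = m"
    and det_eq: "\<And>c b. c \<noteq> 0 \<Longrightarrow> c + real m * b \<noteq> 0 \<Longrightarrow>
      det (1\<^sub>m m + (c \<cdot>\<^sub>m 1\<^sub>m m + b \<cdot>\<^sub>m all_ones_mat m) * mat_on ys1 (signed_laplacian \<sigma> Y1)) =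
      det (1\<^sub>m m + (c \<cdot>\<^sub>m 1\<^sub>m m + b \<cdot>\<^sub>m all_ones_mat m) * mat_on ys2 (signed_laplacian \<sigma> Y2))"
  shows "char_poly (mat_on xs (signed_laplacian \<sigma> (delete_copy X Y1 \<iota>1))) =
    char_poly (mat_on xs (signed_laplacian \<sigma> (delete_copy X Y2 \<iota>2)))"
proof -
  interpret X: pair_graph X by fact
  obtain d where d: "\<And>u. u \<in> pverts X \<Longrightarrow> out_degree (with_proj X) u = d"
    using one_walk_regular_imp_regular[OF X reg] by blast
  let ?n = "card (pverts X)"
  have m_le: "m \<le> ?n"
    using card_mono[OF X.pair_finite_verts, of "\<iota>1 ` pverts Y1"] clique1
      card_image[OF inj1] distinct_card[OF ys1(1)] ys1(2,3) by (simp add: clique_def)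
  show ?thesis
  proof (rule poly_eqI_eventually)
    fix t :: real
    \<comment> \<open>As \<open>X\<close> is regular of degree \<open>d\<close>, its characteristic
      matrix at \<open>t\<close> is \<open>(t - d) I - \<sigma> A\<close>, so the resolvent is taken
      at \<open>s = t - d\<close>.\<close>
    assume t: "t > real d + real (?n * (?n + 3))"
    then have "t - real d > real (?n * (?n + 3))" by simp
    then obtain N \<alpha> \<beta> where
      N: "\<And>u v. u \<in> pverts X \<Longrightarrow>
        (t - real d) * N u v - \<sigma> * (\<Sum>w\<in>pverts X. adj X u w * N w v) = (if u = v then 1 else 0)"
      and diag: "\<And>u. u \<in> pverts X \<Longrightarrow> N u u = \<alpha>"
      and arc: "\<And>u v. (u, v) \<in> parcs X \<Longrightarrow> N u v = \<beta>"
      and nz: "\<And>k. k \<le> ?n \<Longrightarrow> \<alpha> - \<beta> + real k * \<beta> \<noteq> 0"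
      by (rule resolvent_one_walk_regular[OF X reg \<sigma>]) (rule that)
    have inv: "(\<Sum>w\<in>pverts X. ((if u = w then t else 0) - signed_laplacian \<sigma> X u w) * N w v) =
        (if u = v then 1 else 0)" if "u \<in> pverts X" "v \<in> pverts X" for u v
    proof -
      have "(\<Sum>w\<in>pverts X. ((if u = w then t else 0) - signed_laplacian \<sigma> X u w) * N w v) =
          (\<Sum>w\<in>pverts X. (if u = w then (t - real d) * N w v else 0) - \<sigma> * (adj X u w * N w v))"
        by (rule sum.cong) (auto simp: signed_laplacian_def d algebra_simps)
      then show ?thesis
        using N[OF that(1), of v] that
        by (simp add: sum_subtractf sum_distrib_left X.pair_finite_verts)
    qed
    show "poly (char_poly (mat_on xs (signed_laplacian \<sigma> (delete_copy X Y1 \<iota>1)))) t =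
        poly (char_poly (mat_on xs (signed_laplacian \<sigma> (delete_copy X Y2 \<iota>2)))) t"
      using poly_char_poly_delete_copy[OF X Y1 inj1 clique1 inv diag arc xs ys1(1,2)]
        poly_char_poly_delete_copy[OF X Y2 inj2 clique2 inv diag arc xs ys2(1,2)]
        det_eq[of "\<alpha> - \<beta>" \<beta>] nz[of 0] nz[OF m_le]
      by (simp add: ys1(3) ys2(3))
  qed
qed

theorem theorem6p1:
  fixes X :: "'a pair_pre_digraph"
    and Y1 :: "'b pair_pre_digraph" and Y2 :: "'c pair_pre_digraph"
    and \<iota>1 :: "'b \<Rightarrow> 'a" and \<iota>2 :: "'c \<Rightarrow> 'a"
    and \<omega> :: nat
  assumes "pair_graph X" and "one_walk_regular X" and "clique_number X = \<omega>"
    and "pair_graph Y1" and "card (pverts Y1) \<le> \<omega>"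
    and "pair_graph Y2" and "card (pverts Y2) \<le> \<omega>"
    and "inj_on \<iota>1 (pverts Y1)" and "clique X (\<iota>1 ` pverts Y1)"
    and "inj_on \<iota>2 (pverts Y2)" and "clique X (\<iota>2 ` pverts Y2)"
  shows "(laplacian_cospectral Y1 Y2 \<longrightarrow>
            laplacian_cospectral (delete_copy X Y1 \<iota>1) (delete_copy X Y2 \<iota>2)) \<and>
         (unsigned_laplacian_cospectral Y1 Y2 \<and>
          unsigned_laplacian_cospectral (complement Y1) (complement Y2) \<longrightarrow>
            unsigned_laplacian_cospectral (delete_copy X Y1 \<iota>1) (delete_copy X Y2 \<iota>2))"
proof -
  interpret X: pair_graph X by fact
  interpret Y1: pair_graph Y1 by fact
  interpret Y2: pair_graph Y2 by fact
  obtain xs where xs: "set xs = pverts X" "distinct xs"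
    using finite_distinct_list[OF X.pair_finite_verts] by blast
  obtain ys1 where ys1: "set ys1 = pverts Y1" "distinct ys1"
    using finite_distinct_list[OF Y1.pair_finite_verts] by blast
  obtain ys2 where ys2: "set ys2 = pverts Y2" "distinct ys2"
    using finite_distinct_list[OF Y2.pair_finite_verts] by blast
  let ?L1 = "mat_on ys1 (signed_laplacian (-1) Y1)" and ?L2 = "mat_on ys2 (signed_laplacian (-1) Y2)"
  let ?S1 = "mat_on ys1 (signed_laplacian 1 Y1)" and ?S2 = "mat_on ys2 (signed_laplacian 1 Y2)"
  let ?T1 = "mat_on ys1 (signed_laplacian 1 (complement Y1))"
  let ?T2 = "mat_on ys2 (signed_laplacian 1 (complement Y2))"
  \<comment> \<open>The degree of a characteristic polynomial is the size of its matrix, so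
    cospectral graphs have equally many vertices.\<close>
  have len_eq: "length ys2 = length ys1"
    if "char_poly (mat_on ys1 f) = char_poly (mat_on ys2 g)" for f :: "'b \<Rightarrow> 'b \<Rightarrow> real" and g
    using degree_monic_char_poly[OF mat_on_carrier, of ys1 f]
      degree_monic_char_poly[OF mat_on_carrier, of ys2 g] that by simp
  note del = char_poly_delete_copy_eqI[OF assms(1,2) _ assms(4,6,8-11) xs(2,1)
      ys1(2,1) refl ys2(2,1)]
  show ?thesis
  proof (intro conjI impI)
    assume "laplacian_cospectral Y1 Y2"
    then have eq: "char_poly ?L1 = char_poly ?L2"
      using ys1 ys2 by (simp add: laplacian_cospectral_def laplacian_mat_eq
          laplacian_char_poly_eq[OF Y1.pair_finite_verts ys1]
          laplacian_char_poly_eq[OF Y2.pair_finite_verts ys2])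
    note len = len_eq[OF eq]
    let ?m = "length ys1"
    have "char_poly (mat_on xs (signed_laplacian (-1) (delete_copy X Y1 \<iota>1))) =
        char_poly (mat_on xs (signed_laplacian (-1) (delete_copy X Y2 \<iota>2)))"
    proof (rule del[OF _ len])
      fix c b :: real
      assume "c \<noteq> 0"
      have "?L1 \<in> carrier_mat ?m ?m" "?L2 \<in> carrier_mat ?m ?m"
        using mat_on_carrier[of ys2] by (simp_all add: len)
      \<comment> \<open>With the all-ones part gone, each determinant is \<open>(- c) ^ m\<close>
        times the value at \<open>- 1 / c\<close> of the shared characteristic polynomial.\<close>
      from this[THEN det_one_add_smult, OF \<open>c \<noteq> 0\<close>]
      show "det (1\<^sub>m ?m + (c \<cdot>\<^sub>m 1\<^sub>m ?m + b \<cdot>\<^sub>m all_ones_mat ?m) * ?L1) =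
          det (1\<^sub>m ?m + (c \<cdot>\<^sub>m 1\<^sub>m ?m + b \<cdot>\<^sub>m all_ones_mat ?m) * ?L2)"
        using mult_laplacian_eq_smult[OF assms(4) ys1(2,1), of c b]
          mult_laplacian_eq_smult[OF assms(6) ys2(2,1), of c b] by (simp add: eq len)
    qed simp
    then show "laplacian_cospectral (delete_copy X Y1 \<iota>1) (delete_copy X Y2 \<iota>2)"
      using xs by (simp add: laplacian_cospectral_def laplacian_mat_eq X.pair_finite_verts
          laplacian_char_poly_eq[of _ xs] delete_copy_def)
  next
    assume "unsigned_laplacian_cospectral Y1 Y2 \<and>
      unsigned_laplacian_cospectral (complement Y1) (complement Y2)"
    then have eq: "char_poly ?S1 = char_poly ?S2" and eq_c: "char_poly ?T1 = char_poly ?T2"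
      using ys1 ys2 Y1.pair_finite_verts Y2.pair_finite_verts
      by (simp_all add: unsigned_laplacian_cospectral_def unsigned_laplacian_mat_eq
          unsigned_laplacian_char_poly_eq[of _ ys1] unsigned_laplacian_char_poly_eq[of _ ys2]
          complement_def)
    note len = len_eq[OF eq]
    let ?m = "length ys1"
    have "char_poly (mat_on xs (signed_laplacian 1 (delete_copy X Y1 \<iota>1))) =
        char_poly (mat_on xs (signed_laplacian 1 (delete_copy X Y2 \<iota>2)))"
    proof (rule del[OF _ len])
      fix c b :: real
      assume "c \<noteq> 0" "c + real ?m * b \<noteq> 0"
      moreover have "?S1 \<in> carrier_mat ?m ?m" "?S2 \<in> carrier_mat ?m ?m"
        using mat_on_carrier[of ys2] by (simp_all add: len)
      \<comment> \<open>Both sides are the same expression in \<open>c\<close>, \<open>b\<close>,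
        \<open>m\<close> and the characteristic polynomials of the graph and of its complement,
        which agree by hypothesis.\<close>
      ultimately show "det (1\<^sub>m ?m + (c \<cdot>\<^sub>m 1\<^sub>m ?m + b \<cdot>\<^sub>m all_ones_mat ?m) * ?S1) =
          det (1\<^sub>m ?m + (c \<cdot>\<^sub>m 1\<^sub>m ?m + b \<cdot>\<^sub>m all_ones_mat ?m) * ?S2)"
        using det_one_add_mult_all_ones[OF _ _ _ unsigned_laplacian_complement[OF assms(4) ys1(2,1)], of c b]
          det_one_add_mult_all_ones[OF _ _ _ unsigned_laplacian_complement[OF assms(6) ys2(2,1)], of c b]
        by (simp add: eq eq_c len)
    qed simp
    then show "unsigned_laplacian_cospectral (delete_copy X Y1 \<iota>1) (delete_copy X Y2 \<iota>2)"
      using xs by (simp add: unsigned_laplacian_cospectral_def unsigned_laplacian_mat_eq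
          X.pair_finite_verts unsigned_laplacian_char_poly_eq[of _ xs] delete_copy_def)
  qed
qed

end
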